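(* Let $A$ be an associative and commutative ring with unit, let $\Gamma=EL_6(A)$, and let $G=EL_2(A)$, regarded as the subgroup of $\Gamma$ in the upper-left corner via $g\mapsto\begin{pmatrix} g&0\\0&I_4\end{pmatrix}$. If $\phi$ is a homogeneous quasi-homomorphism on $\Gamma$, then $\phi(g)=0$ for all $g\in G$.
   Context: For an associative ring $B$ with unit, an elementary matrix in $M_n(B)$ is a matrix whose diagonal entries are $1$ and all of whose off-diagonal entries except at most one are $0$; $EL_n(B)$ is the group generated by all elementary matrices in $M_n(B)$. A quasi-homomorphism on a group $\Gamma$ is a function $\phi\colon\Gamma\to\mathbb{R}$ with $\sup_{g,h\in\Gamma}|\phi(gh)-\phi(g)-\phi(h)|<\infty$; it is homogeneous if $\phi(g^m)=m\,\phi(g)$ for all $g\in\Gamma$ and $m\in\mathbb{Z}$. *)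

theory Defs
  imports "Jordan_Normal_Form.Matrix" "HOL-Algebra.Group"
begin

definition elementary_mat :: "nat \<Rightarrow> 'a::comm_ring_1 mat \<Rightarrow> bool" where
  "elementary_mat n M \<longleftrightarrow> M \<in> carrier_mat n n \<and>
     (\<forall>i<n. M $$ (i,i) = 1) \<and>
     (\<forall>i j k l. i < n \<and> j < n \<and> k < n \<and> l < n \<and> i \<noteq> j \<and> k \<noteq> l \<and>
        M $$ (i,j) \<noteq> 0 \<and> M $$ (k,l) \<noteq> 0 \<longrightarrow> (i,j) = (k,l))"

inductive_set EL :: "nat \<Rightarrow> 'a::comm_ring_1 mat set" for n where
  gen: "elementary_mat n M \<Longrightarrow> M \<in> EL n"
| mult: "M \<in> EL n \<Longrightarrow> N \<in> EL n \<Longrightarrow> M * N \<in> EL n"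
| inv: "M \<in> EL n \<Longrightarrow> N \<in> carrier_mat n n \<Longrightarrow> M * N = 1\<^sub>m n \<Longrightarrow> N * M = 1\<^sub>m n \<Longrightarrow> N \<in> EL n"

definition EL_group :: "nat \<Rightarrow> 'a::comm_ring_1 mat monoid" where
  "EL_group n = \<lparr>carrier = EL n, mult = (\<lambda>M N. M * N), one = 1\<^sub>m n\<rparr>"

definition quasi_hom :: "'g monoid \<Rightarrow> ('g \<Rightarrow> real) \<Rightarrow> bool" where
  "quasi_hom \<Gamma> \<phi> \<longleftrightarrow> (\<exists>C. \<forall>g\<in>carrier \<Gamma>. \<forall>h\<in>carrier \<Gamma>.
      \<bar>\<phi> (g \<otimes>\<^bsub>\<Gamma>\<^esub> h) - \<phi> g - \<phi> h\<bar> \<le> C)"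

definition homogeneous :: "'g monoid \<Rightarrow> ('g \<Rightarrow> real) \<Rightarrow> bool" where
  "homogeneous \<Gamma> \<phi> \<longleftrightarrow> (\<forall>g\<in>carrier \<Gamma>. \<forall>m::int. \<phi> (g [^]\<^bsub>\<Gamma>\<^esub> m) = of_int m * \<phi> g)"

definition corner_embed :: "'a::comm_ring_1 mat \<Rightarrow> 'a mat" where
  "corner_embed g = four_block_mat g (0\<^sub>m 2 4) (0\<^sub>m 4 2) (1\<^sub>m 4)"

end

theory Submission
  imports Defs "Jordan_Normal_Form.Gauss_Jordan_Elimination"
begin

text \<open>The value of \<open>\<phi>\<close> on an element of \<open>EL\<^sub>2\<close> depends, up to a bounded error, only on its first
  row \<open>(a, b)\<close>. This gives a function \<open>m a b\<close> which satisfies the axioms of a Mennicke symbol up to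
  a bounded error, since their proof in \<open>3 \<times> 3\<close> matrices uses a bounded number of transvections, and
  \<open>\<phi>\<close> is bounded on these because they are commutators. As \<open>A\<close> is commutative, \<open>b \<mapsto> m a b\<close> is
  a quasi-homomorphism on a commutative monoid, so its homogenization \<open>\<mu>\<close> is exactly multiplicative, and it turns
  out to be exactly invariant under elementary operations on the row. Every row of an element of
  \<open>EL\<^sub>2\<close> is reached from \<open>(1, 0)\<close> by such operations, so \<open>\<mu>\<close> vanishes there and \<open>\<phi>\<close> is bounded on
  \<open>EL\<^sub>2\<close>; being homogeneous, it is zero.\<close>

section \<open>Quasi-additive sequences\<close>

text \<open>By the Archimedean property \<open>n * \<bar>x - y\<bar>\<close> is unbounded unless
  \<open>x = y\<close>. Each passage from a bounded error to an exact identity goes through this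
  lemma.\<close>

lemma eq_of_bounded_multiples:
  fixes x y K :: real
  assumes "\<And>n::nat. n \<ge> 1 \<Longrightarrow> \<bar>real n * x - real n * y\<bar> \<le> K"
  shows "x = y"
proof (rule ccontr)
  assume "x \<noteq> y"
  then have pos: "0 < \<bar>x - y\<bar>" by simp
  obtain n :: nat where n: "K < real n * \<bar>x - y\<bar>"
    using ex_less_of_nat_mult[OF pos] by blast
  have "K < real (Suc n) * \<bar>x - y\<bar>"
    using n pos by (simp add: algebra_simps)
  moreover have "real (Suc n) * \<bar>x - y\<bar> = \<bar>real (Suc n) * x - real (Suc n) * y\<bar>"
    by (metis abs_mult abs_of_nat right_diff_distrib)
  ultimately show False using assms[of "Suc n"] by simp
qed

lemma quasi_additive_multiple:
  fixes f :: "nat \<Rightarrow> real"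
  assumes quasi: "\<And>m n. m \<ge> 1 \<Longrightarrow> n \<ge> 1 \<Longrightarrow> \<bar>f (m + n) - f m - f n\<bar> \<le> c"
    and m: "m \<ge> 1" and n: "n \<ge> 1"
  shows "\<bar>f (m * n) - real m * f n\<bar> \<le> (real m - 1) * c"
  using m
proof (induction m rule: dec_induct)
  case base
  then show ?case by simp
next
  case (step m)
  have "f (Suc m * n) = f (m * n + n)" by (simp add: add.commute)
  moreover have "\<bar>f (m * n + n) - f (m * n) - f n\<bar> \<le> c"
    using step.hyps n by (intro quasi) auto
  ultimately show ?case using step.IH by (simp add: algebra_simps)
qed

text \<open>Estimating \<open>f (m * n)\<close> through \<open>f n\<close> and through
  \<open>f m\<close> shows that every \<open>(f n - c) / n\<close> lies below every
  \<open>(f m + c) / m\<close>. The supremum of the former separates the two families and serves as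
  the slope.\<close>

lemma quasi_additive_slope:
  fixes f :: "nat \<Rightarrow> real"
  assumes quasi: "\<And>m n. m \<ge> 1 \<Longrightarrow> n \<ge> 1 \<Longrightarrow> \<bar>f (m + n) - f m - f n\<bar> \<le> c"
  shows "\<exists>s. \<forall>n\<ge>1. \<bar>f n - real n * s\<bar> \<le> c"
proof -
  have le: "(f n - c) / real n \<le> (f m + c) / real m" if m: "m \<ge> 1" and n: "n \<ge> 1" for m n
  proof -
    have "\<bar>f (m * n) - real m * f n\<bar> \<le> (real m - 1) * c"
      "\<bar>f (m * n) - real n * f m\<bar> \<le> (real n - 1) * c"
      using quasi_additive_multiple[OF quasi m n] quasi_additive_multiple[OF quasi n m]
      by (simp_all add: mult.commute)
    moreover have "0 \<le> c" using quasi[of 1 1] by linarith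
    ultimately have "(f n - c) * real m \<le> (f m + c) * real n"
      by (simp add: algebra_simps)
    with m n show ?thesis by (simp add: divide_simps)
  qed
  define s where "s = (SUP n\<in>{1..}. (f n - c) / real n)"
  have bdd: "bdd_above ((\<lambda>n. (f n - c) / real n) ` {1..})"
    using le[of 1] by (intro bdd_aboveI2[where M = "(f 1 + c) / real 1"]) auto
  have "\<bar>f n - real n * s\<bar> \<le> c" if n: "n \<ge> 1" for n
  proof -
    have "(f n - c) / real n \<le> s"
      unfolding s_def using n bdd by (intro cSUP_upper) auto
    moreover have "s \<le> (f n + c) / real n"
      unfolding s_def using le[OF n] by (intro cSUP_least) auto
    ultimately show ?thesis using n by (simp add: divide_simps abs_le_iff mult.commute)
  qed
  then show ?thesis by blast
qed

section \<open>Approximate Mennicke symbols\<close>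

lemma power_add_mult_ex:
  fixes a b t :: "'a :: comm_ring_1"
  shows "\<exists>s. (a + t * b) ^ n = a ^ n + s * b"
proof (induction n)
  case 0
  show ?case by (rule exI[of _ 0]) simp
next
  case (Suc n)
  then obtain s where "(a + t * b) ^ n = a ^ n + s * b" by blast
  then have "(a + t * b) ^ Suc n = a ^ Suc n + (t * a ^ n + (a + t * b) * s) * b"
    by (simp add: algebra_simps)
  then show ?case by blast
qed

text \<open>Mennicke symbol axioms in additive notation, with error \<open>c\<close>;
  \<open>P\<close> marks the rows on which the symbol is meaningful.\<close>

locale approx_mennicke =
  fixes P :: "'a :: comm_ring_1 \<Rightarrow> 'a \<Rightarrow> bool" and m :: "'a \<Rightarrow> 'a \<Rightarrow> real" and c :: real
  assumes P_mult_snd: "P a b \<Longrightarrow> P a b' \<Longrightarrow> P a (b * b')"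
    and m_mult_snd: "P a b \<Longrightarrow> P a b' \<Longrightarrow> \<bar>m a (b * b') - m a b - m a b'\<bar> \<le> c"
    and P_mult_fst: "P a b \<Longrightarrow> P a' b \<Longrightarrow> P (a * a') b"
    and m_mult_fst: "P a b \<Longrightarrow> P a' b \<Longrightarrow> \<bar>m (a * a') b - m a b - m a' b\<bar> \<le> c"
    and P_add_fst: "P a b \<Longrightarrow> P (a + t * b) b"
    and m_add_fst: "P a b \<Longrightarrow> \<bar>m (a + t * b) b - m a b\<bar> \<le> c"
    and P_add_snd: "P a b \<Longrightarrow> P a (b + t * a)"
    and m_add_snd: "P a b \<Longrightarrow> \<bar>m a (b + t * a) - m a b\<bar> \<le> c"
    and P_one_zero: "P 1 0"
begin

text \<open>On rows in \<open>P\<close> this is the limit of \<open>m a (b ^ n) / n\<close>; the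
  bounded error makes the chosen slope unique.\<close>

definition mu :: "'a \<Rightarrow> 'a \<Rightarrow> real" where
  "mu a b = (SOME s. \<forall>n\<ge>1. \<bar>m a (b ^ n) - real n * s\<bar> \<le> c)"

lemma P_power_snd:
  assumes "P a b" "n \<ge> 1"
  shows "P a (b ^ n)"
  using assms(2) by (induction n rule: dec_induct) (simp_all add: assms(1) P_mult_snd)

lemma P_power_fst:
  assumes "P a b" "n \<ge> 1"
  shows "P (a ^ n) b"
  using assms(2) by (induction n rule: dec_induct) (simp_all add: assms(1) P_mult_fst)

lemma mu_approx:
  assumes "P a b" and n: "n \<ge> 1"
  shows "\<bar>m a (b ^ n) - real n * mu a b\<bar> \<le> c"
proof -
  have "\<exists>s. \<forall>n\<ge>1. \<bar>m a (b ^ n) - real n * s\<bar> \<le> c"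
    by (rule quasi_additive_slope)
      (simp add: power_add m_mult_snd P_power_snd assms(1))
  from someI_ex[OF this] show ?thesis using n unfolding mu_def by blast
qed

lemma mu_approx_one: "P a b \<Longrightarrow> \<bar>m a b - mu a b\<bar> \<le> c"
  using mu_approx[of a b 1] by simp

lemma m_power_fst:
  assumes "P a b" and n: "n \<ge> 1"
  shows "\<bar>m (a ^ n) b - real n * m a b\<bar> \<le> (real n - 1) * c"
  using quasi_additive_multiple[of "\<lambda>n. m (a ^ n) b" c n 1] n
  by (simp add: power_add m_mult_fst P_power_fst assms(1))

lemma mu_power_snd:
  assumes P: "P a b" and k: "k \<ge> 1"
  shows "mu a (b ^ k) = real k * mu a b"
proof (rule eq_of_bounded_multiples)
  fix n :: nat assume n: "n \<ge> 1"
  have "\<bar>m a ((b ^ k) ^ n) - real n * mu a (b ^ k)\<bar> \<le> c"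
    by (rule mu_approx[OF P_power_snd[OF P k] n])
  moreover have "\<bar>m a (b ^ (k * n)) - real (k * n) * mu a b\<bar> \<le> c"
    using k n by (intro mu_approx[OF P]) auto
  ultimately show "\<bar>real n * mu a (b ^ k) - real n * (real k * mu a b)\<bar> \<le> 2 * c"
    by (simp add: power_mult[symmetric] algebra_simps)
qed

text \<open>For fixed \<open>k\<close> the error of \<open>m\<close> in the first entry is
  independent of \<open>n\<close>, so homogenizing in the second entry removes it as well.\<close>

lemma mu_power_fst:
  assumes P: "P a b" and k: "k \<ge> 1"
  shows "mu (a ^ k) b = real k * mu a b"
proof (rule eq_of_bounded_multiples)
  fix n :: nat assume n: "n \<ge> 1"
  have "\<bar>m (a ^ k) (b ^ n) - real n * mu (a ^ k) b\<bar> \<le> c"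
    by (rule mu_approx[OF P_power_fst[OF P k] n])
  moreover have "\<bar>m (a ^ k) (b ^ n) - real k * m a (b ^ n)\<bar> \<le> (real k - 1) * c"
    by (rule m_power_fst[OF P_power_snd[OF P n] k])
  moreover have "\<bar>real k * m a (b ^ n) - real k * (real n * mu a b)\<bar> \<le> real k * c"
    using mult_left_mono[OF mu_approx[OF P n], of "real k"]
    by (simp add: abs_mult flip: right_diff_distrib)
  ultimately show "\<bar>real n * mu (a ^ k) b - real n * (real k * mu a b)\<bar> \<le> 2 * real k * c"
    by (simp add: algebra_simps)
qed

text \<open>Passing to powers makes the bounded error of \<open>m\<close> under elementary moves disappear, because
  \<open>(a + t b)\<^sup>n\<close> and \<open>a\<^sup>n\<close> again differ by a multiple of \<open>b\<close>.\<close>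

lemma mu_add_fst:
  assumes P: "P a b"
  shows "mu (a + t * b) b = mu a b"
proof (rule eq_of_bounded_multiples)
  fix n :: nat assume n: "n \<ge> 1"
  obtain s where s: "(a + t * b) ^ n = a ^ n + s * b"
    using power_add_mult_ex by blast
  have P': "P (a ^ n) b" by (rule P_power_fst[OF P n])
  \<comment> \<open>One \<open>c\<close> for the move of \<open>m\<close>, one for each of the two
    passages between \<open>m\<close> and \<open>mu\<close>.\<close>
  have "\<bar>mu (a ^ n + s * b) b - mu (a ^ n) b\<bar> \<le> 3 * c"
    using m_add_fst[OF P', of s] mu_approx_one[OF P'] mu_approx_one[OF P_add_fst[OF P', of s]]
    by linarith
  then show "\<bar>real n * mu (a + t * b) b - real n * mu a b\<bar> \<le> 3 * c"
    using mu_power_fst[OF P n] mu_power_fst[OF P_add_fst[OF P, of t] n] s by simp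
qed

lemma mu_add_snd:
  assumes P: "P a b"
  shows "mu a (b + t * a) = mu a b"
proof (rule eq_of_bounded_multiples)
  fix n :: nat assume n: "n \<ge> 1"
  obtain s where s: "(b + t * a) ^ n = b ^ n + s * a"
    using power_add_mult_ex by blast
  have P': "P a (b ^ n)" by (rule P_power_snd[OF P n])
  have "\<bar>mu a (b ^ n + s * a) - mu a (b ^ n)\<bar> \<le> 3 * c"
    using m_add_snd[OF P', of s] mu_approx_one[OF P'] mu_approx_one[OF P_add_snd[OF P', of s]]
    by linarith
  then show "\<bar>real n * mu a (b + t * a) - real n * mu a b\<bar> \<le> 3 * c"
    using mu_power_snd[OF P n] mu_power_snd[OF P_add_snd[OF P, of t] n] s by simp
qed

text \<open>Since \<open>0 ^ n = 0\<close> for positive \<open>n\<close>, the sequence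
  \<open>m 1 (0 ^ n)\<close> is constant and its slope is zero.\<close>

lemma mu_one_zero: "mu 1 0 = 0"
proof (rule eq_of_bounded_multiples)
  fix n :: nat assume n: "n \<ge> 1"
  then have "\<bar>m 1 0 - real n * mu 1 0\<bar> \<le> c"
    using mu_approx[OF P_one_zero n] by (simp add: power_0_left)
  moreover have "\<bar>m 1 0\<bar> \<le> c"
    using m_mult_snd[OF P_one_zero P_one_zero] by simp
  ultimately show "\<bar>real n * mu 1 0 - real n * 0\<bar> \<le> 2 * c" by simp
qed

end

section \<open>Elementary groups and stabilization\<close>

lemma elementary_mat_addrow:
  assumes "k < n" "l < n" "k \<noteq> l"
  shows "elementary_mat n (addrow_mat n a k l)"
  unfolding elementary_mat_def using assms by (auto split: if_splits)

lemma elementary_mat_cases: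
  assumes M: "elementary_mat n M" and n: "n \<ge> 2"
  obtains k l t where "k < n" "l < n" "k \<noteq> l" "M = addrow_mat n t k l"
proof -
  have C: "M \<in> carrier_mat n n" and diag: "\<And>i. i < n \<Longrightarrow> M $$ (i, i) = 1"
    and off: "\<And>i j k l. i < n \<Longrightarrow> j < n \<Longrightarrow> k < n \<Longrightarrow> l < n \<Longrightarrow> i \<noteq> j \<Longrightarrow> k \<noteq> l \<Longrightarrow>
        M $$ (i,j) \<noteq> 0 \<Longrightarrow> M $$ (k,l) \<noteq> 0 \<Longrightarrow> (i,j) = (k,l)"
    using M unfolding elementary_mat_def by blast+
  show ?thesis
  proof (cases "\<exists>k<n. \<exists>l<n. k \<noteq> l \<and> M $$ (k, l) \<noteq> 0")
    case True
    then obtain k l where kl: "k < n" "l < n" "k \<noteq> l" "M $$ (k, l) \<noteq> 0" by blast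
    have "M = addrow_mat n (M $$ (k, l)) k l"
    proof (rule eq_matI)
      fix i j assume "i < dim_row (addrow_mat n (M $$ (k, l)) k l)"
        "j < dim_col (addrow_mat n (M $$ (k, l)) k l)"
      then have ij: "i < n" "j < n" by auto
      have "M $$ (i, j) = 0" if "i \<noteq> j" "(i, j) \<noteq> (k, l)"
        using off[OF ij kl(1,2) that(1) kl(3) _ kl(4)] that(2) by blast
      with ij kl(3) show "M $$ (i, j) = addrow_mat n (M $$ (k, l)) k l $$ (i, j)"
        by (cases "i = j") (auto simp: diag)
    qed (use C in auto)
    then show ?thesis using kl that by blast
  next
    case False
    \<comment> \<open>The identity counts as a transvection with parameter 0; position (0,1) exists
      because \<open>n \<ge> 2\<close>.\<close>
    then have "M = addrow_mat n 0 0 1"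
      using C by (intro eq_matI) (auto simp: diag)
    then show ?thesis using n that[of 0 1 0] by simp
  qed
qed

lemma EL_carrier: "M \<in> EL n \<Longrightarrow> M \<in> carrier_mat n n"
  by (induction rule: EL.induct) (auto simp: elementary_mat_def)

text \<open>Block sum with an identity of arbitrary size, so that the embedding of size 2 into size
  6 can be factored through size 3.\<close>

definition stab :: "nat \<Rightarrow> 'a :: comm_ring_1 mat \<Rightarrow> 'a mat" where
  "stab k M = four_block_mat M (0\<^sub>m (dim_row M) k) (0\<^sub>m k (dim_col M)) (1\<^sub>m k)"

lemma stab_carrier: "M \<in> carrier_mat n n \<Longrightarrow> stab k M \<in> carrier_mat (n + k) (n + k)"
  unfolding stab_def by auto

lemma stab_mult:
  assumes "M \<in> carrier_mat n n" "N \<in> carrier_mat n n"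
  shows "stab k (M * N) = stab k M * stab k N"
proof -
  have "stab k M * stab k N = four_block_mat (M * N + 0\<^sub>m n k * 0\<^sub>m k n)
     (M * 0\<^sub>m n k + 0\<^sub>m n k * 1\<^sub>m k) (0\<^sub>m k n * N + 1\<^sub>m k * 0\<^sub>m k n) (0\<^sub>m k n * 0\<^sub>m n k + 1\<^sub>m k * 1\<^sub>m k)"
    unfolding stab_def using assms by (subst mult_four_block_mat) auto
  also have "\<dots> = stab k (M * N)"
    unfolding stab_def using assms by (intro arg_cong4[where f = four_block_mat]) auto
  finally show ?thesis ..
qed

lemma stab_one: "stab k (1\<^sub>m n) = 1\<^sub>m (n + k)"
  unfolding stab_def by (rule eq_matI) auto

lemma stab_elementary:
  assumes "elementary_mat n M"
  shows "elementary_mat (n + k) (stab k M)"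
proof -
  have C: "M \<in> carrier_mat n n" and d: "\<And>i. i < n \<Longrightarrow> M $$ (i, i) = 1"
    and o: "\<And>i j k l. i < n \<Longrightarrow> j < n \<Longrightarrow> k < n \<Longrightarrow> l < n \<Longrightarrow> i \<noteq> j \<Longrightarrow> k \<noteq> l \<Longrightarrow>
        M $$ (i,j) \<noteq> 0 \<Longrightarrow> M $$ (k,l) \<noteq> 0 \<Longrightarrow> (i,j) = (k,l)"
    using assms unfolding elementary_mat_def by blast+
  have off: "i < n \<and> j < n \<and> M $$ (i, j) \<noteq> 0"
    if "i < n + k" "j < n + k" "i \<noteq> j" "stab k M $$ (i, j) \<noteq> 0" for i j
    using that C unfolding stab_def by (auto split: if_splits)
  show ?thesis
    unfolding elementary_mat_def
  proof (intro conjI allI impI)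
    show "stab k M \<in> carrier_mat (n + k) (n + k)" by (rule stab_carrier[OF C])
    show "stab k M $$ (i, i) = 1" if "i < n + k" for i
      using that C d unfolding stab_def by auto
    fix i j p q
    assume "i < n + k \<and> j < n + k \<and> p < n + k \<and> q < n + k \<and> i \<noteq> j \<and> p \<noteq> q \<and>
      stab k M $$ (i, j) \<noteq> 0 \<and> stab k M $$ (p, q) \<noteq> 0"
    then show "(i, j) = (p, q)"
      using off[of i j] off[of p q] o[of i j p q] by blast
  qed
qed

lemma stab_EL: "M \<in> EL n \<Longrightarrow> stab k M \<in> EL (n + k)"
proof (induction rule: EL.induct)
  case (gen M)
  then show ?case by (intro EL.gen stab_elementary)
next
  case (mult M N)
  then show ?case using stab_mult[OF EL_carrier EL_carrier] by (metis EL.mult)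
next
  case (inv M N)
  note C = EL_carrier[OF inv(1)] inv(2)
  show ?case
    using inv C by (intro EL.inv[OF inv.IH stab_carrier]) (auto simp: stab_mult[symmetric] stab_one)
qed

lemma stab_stab: "M \<in> carrier_mat n n \<Longrightarrow> stab k (stab l M) = stab (l + k) M"
  unfolding stab_def by (rule eq_matI) auto

section \<open>The symbol of a quasi-homomorphism on 3 by 3 matrices\<close>

text \<open>Nine explicit entries turn matrix identities into ring identities.\<close>

definition mat3 :: "'a \<Rightarrow> 'a \<Rightarrow> 'a \<Rightarrow> 'a \<Rightarrow> 'a \<Rightarrow> 'a \<Rightarrow> 'a \<Rightarrow> 'a \<Rightarrow> 'a \<Rightarrow> 'a mat" where
  "mat3 a b c d e f g h i = mat 3 3 (\<lambda>(p, q). [[a, b, c], [d, e, f], [g, h, i]] ! p ! q)"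

lemma mat3_carrier [simp]: "mat3 a b c d e f g h i \<in> carrier_mat 3 3"
  unfolding mat3_def by auto

lemma mat3_eqI:
  assumes "a = a'" "b = b'" "c = c'" "d = d'" "e = e'" "f = f'" "g = g'" "h = h'" "i = i'"
  shows "mat3 a b c d e f g h i = mat3 a' b' c' d' e' f' g' h' i'"
  using assms by simp

lemma less_3_iff: "(i :: nat) < 3 \<longleftrightarrow> i = 0 \<or> i = 1 \<or> i = 2"
  by auto

lemma sum_upto_3: "sum g {0..<3 :: nat} = g 0 + g 1 + (g 2 :: 'a :: comm_monoid_add)"
  by (simp add: eval_nat_numeral add.assoc)

lemma mat3_mult:
  fixes a :: "'a :: comm_ring_1"
  shows "mat3 a b c d e f g h i * mat3 a' b' c' d' e' f' g' h' i' =
    mat3 (a*a' + b*d' + c*g') (a*b' + b*e' + c*h') (a*c' + b*f' + c*i')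
         (d*a' + e*d' + f*g') (d*b' + e*e' + f*h') (d*c' + e*f' + f*i')
         (g*a' + h*d' + i*g') (g*b' + h*e' + i*h') (g*c' + h*f' + i*i')"
  by (rule eq_matI)
    (auto simp: mat3_def less_3_iff scalar_prod_def sum_upto_3)

lemma mat3_one: "1\<^sub>m 3 = mat3 1 0 0 0 1 0 0 0 1"
  by (rule eq_matI) (auto simp: mat3_def less_3_iff)

lemma addrow_mat3:
  fixes a :: "'a :: comm_ring_1"
  shows "addrow_mat 3 a 0 (Suc 0) = mat3 1 a 0 0 1 0 0 0 1"
    "addrow_mat 3 a 0 2 = mat3 1 0 a 0 1 0 0 0 1"
    "addrow_mat 3 a (Suc 0) 0 = mat3 1 0 0 a 1 0 0 0 1"
    "addrow_mat 3 a (Suc 0) 2 = mat3 1 0 0 0 1 a 0 0 1"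
    "addrow_mat 3 a 2 0 = mat3 1 0 0 0 1 0 a 0 1"
    "addrow_mat 3 a 2 (Suc 0) = mat3 1 0 0 0 1 0 0 a 1"
  by (rule eq_matI; auto simp: mat3_def less_3_iff)+

section \<open>Uniform bounds on transvections, rotations and signed cycles\<close>

locale quasi_hom_mat3 =
  fixes H :: "'a :: comm_ring_1 mat set" and f :: "'a mat \<Rightarrow> real" and C :: real
  assumes H_mult: "x \<in> H \<Longrightarrow> y \<in> H \<Longrightarrow> x * y \<in> H"
    and H_addrow: "k < 3 \<Longrightarrow> l < 3 \<Longrightarrow> k \<noteq> l \<Longrightarrow> addrow_mat 3 a k l \<in> H"
    and f_quasi: "x \<in> H \<Longrightarrow> y \<in> H \<Longrightarrow> \<bar>f (x * y) - f x - f y\<bar> \<le> C"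
begin

text \<open>Bounds are counted in units of the defect \<open>C\<close>, so that they are uniform in
  the ring parameters; each product costs one unit.\<close>

definition bnd :: "'a mat \<Rightarrow> real \<Rightarrow> bool" where
  "bnd x r \<longleftrightarrow> x \<in> H \<and> \<bar>f x\<bar> \<le> r * C"

lemma bnd_mem: "bnd x r \<Longrightarrow> x \<in> H"
  unfolding bnd_def by simp

lemma bnd_mult: "bnd x r \<Longrightarrow> bnd y s \<Longrightarrow> bnd (x * y) (r + s + 1)"
  using f_quasi[of x y] unfolding bnd_def by (auto simp: H_mult algebra_simps)

lemma one_mem: "1\<^sub>m 3 \<in> H"
  using H_addrow[of 0 "Suc 0" 0] by (simp add: addrow_mat3 mat3_one)

lemma bnd_one: "bnd (1\<^sub>m 3) 1"
  using f_quasi[OF one_mem one_mem] unfolding bnd_def by (simp add: one_mem)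

lemma C_nonneg: "0 \<le> C"
  using f_quasi[OF one_mem one_mem] by linarith

text \<open>The values at an element and its inverse cancel up to \<open>2 * C\<close>; two such
  pairs and three products give 7.\<close>

lemma bnd_commutator:
  assumes "x \<in> H" "y \<in> H" "x' \<in> H" "y' \<in> H" "x * x' = 1\<^sub>m 3" "y * y' = 1\<^sub>m 3"
  shows "bnd (x * y * x' * y') 7"
proof -
  have "\<bar>f x + f x'\<bar> \<le> 2 * C" "\<bar>f y + f y'\<bar> \<le> 2 * C"
    using f_quasi[of x x'] f_quasi[of y y'] bnd_one assms unfolding bnd_def by auto
  moreover have "\<bar>f (x * y) - f x - f y\<bar> \<le> C" "\<bar>f (x * y * x') - f (x * y) - f x'\<bar> \<le> C"
    "\<bar>f (x * y * x' * y') - f (x * y * x') - f y'\<bar> \<le> C"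
    using assms by (auto intro!: f_quasi H_mult)
  ultimately have "\<bar>f (x * y * x' * y')\<bar> \<le> 7 * C" by linarith
  then show ?thesis unfolding bnd_def using assms by (auto intro!: H_mult)
qed

lemmas H_transvections =
  H_addrow[of 0 "Suc 0", unfolded addrow_mat3, simplified]
  H_addrow[of 0 2, unfolded addrow_mat3, simplified]
  H_addrow[of "Suc 0" 0, unfolded addrow_mat3, simplified]
  H_addrow[of "Suc 0" 2, unfolded addrow_mat3, simplified]
  H_addrow[of 2 0, unfolded addrow_mat3, simplified]
  H_addrow[of 2 "Suc 0", unfolded addrow_mat3, simplified]

text \<open>With \<open>k\<close> the third index, the transvection at \<open>(i, j)\<close> with
  parameter \<open>a\<close> is the commutator of those at \<open>(i, k)\<close> with
  \<open>a\<close> and at \<open>(k, j)\<close> with 1. The bound does not depend on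
  \<open>a\<close>.\<close>

lemma bnd_transvections:
  "bnd (mat3 1 a 0 0 1 0 0 0 1) 7"
  "bnd (mat3 1 0 a 0 1 0 0 0 1) 7"
  "bnd (mat3 1 0 0 a 1 0 0 0 1) 7"
  "bnd (mat3 1 0 0 0 1 a 0 0 1) 7"
  "bnd (mat3 1 0 0 0 1 0 a 0 1) 7"
  "bnd (mat3 1 0 0 0 1 0 0 a 1) 7"
proof -
  note simps = mat3_mult mat3_one
  show "bnd (mat3 1 a 0 0 1 0 0 0 1) 7"
    using bnd_commutator[OF H_transvections(2)[of a] H_transvections(6)[of 1]
        H_transvections(2)[of "- a"] H_transvections(6)[of "- 1"]] by (simp add: simps)
  show "bnd (mat3 1 0 a 0 1 0 0 0 1) 7"
    using bnd_commutator[OF H_transvections(1)[of a] H_transvections(4)[of 1]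
        H_transvections(1)[of "- a"] H_transvections(4)[of "- 1"]] by (simp add: simps)
  show "bnd (mat3 1 0 0 a 1 0 0 0 1) 7"
    using bnd_commutator[OF H_transvections(4)[of a] H_transvections(5)[of 1]
        H_transvections(4)[of "- a"] H_transvections(5)[of "- 1"]] by (simp add: simps)
  show "bnd (mat3 1 0 0 0 1 a 0 0 1) 7"
    using bnd_commutator[OF H_transvections(3)[of a] H_transvections(2)[of 1]
        H_transvections(3)[of "- a"] H_transvections(2)[of "- 1"]] by (simp add: simps)
  show "bnd (mat3 1 0 0 0 1 0 a 0 1) 7"
    using bnd_commutator[OF H_transvections(6)[of a] H_transvections(3)[of 1]
        H_transvections(6)[of "- a"] H_transvections(3)[of "- 1"]] by (simp add: simps)
  show "bnd (mat3 1 0 0 0 1 0 0 a 1) 7"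
    using bnd_commutator[OF H_transvections(5)[of a] H_transvections(1)[of 1]
        H_transvections(5)[of "- a"] H_transvections(1)[of "- 1"]] by (simp add: simps)
qed

text \<open>A rotation by a right angle is a product of three transvections with parameters 1 and
  -1: three bounds of 7 and two products.\<close>

lemma bnd_rotations:
  "bnd (mat3 0 1 0 (- 1) 0 0 0 0 1) 23"
  "bnd (mat3 0 (- 1) 0 1 0 0 0 0 1) 23"
  "bnd (mat3 1 0 0 0 0 1 0 (- 1) 0) 23"
  "bnd (mat3 1 0 0 0 0 (- 1) 0 1 0) 23"
  using bnd_mult[OF bnd_mult[OF bnd_transvections(1)[of 1] bnd_transvections(3)[of "- 1"]] bnd_transvections(1)[of 1]]
    bnd_mult[OF bnd_mult[OF bnd_transvections(1)[of "- 1"] bnd_transvections(3)[of 1]] bnd_transvections(1)[of "- 1"]]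
    bnd_mult[OF bnd_mult[OF bnd_transvections(4)[of 1] bnd_transvections(6)[of "- 1"]] bnd_transvections(4)[of 1]]
    bnd_mult[OF bnd_mult[OF bnd_transvections(4)[of "- 1"] bnd_transvections(6)[of 1]] bnd_transvections(4)[of "- 1"]]
  by (simp_all add: mat3_mult)

lemma bnd_cycles:
  "bnd (mat3 0 0 1 (- 1) 0 0 0 (- 1) 0) 47"
  "bnd (mat3 0 (- 1) 0 0 0 (- 1) 1 0 0) 47"
  using bnd_mult[OF bnd_rotations(1) bnd_rotations(3)] bnd_mult[OF bnd_rotations(4) bnd_rotations(2)]
  by (simp_all add: mat3_mult)

section \<open>Completions of a row and the approximate Mennicke relations\<close>

definition completes :: "'a \<Rightarrow> 'a \<Rightarrow> 'a \<Rightarrow> 'a \<Rightarrow> bool" where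
  "completes a b c d \<longleftrightarrow> a * d - b * c = 1 \<and> mat3 a b 0 c d 0 0 0 1 \<in> H"

definition rowP :: "'a \<Rightarrow> 'a \<Rightarrow> bool" where
  "rowP a b \<longleftrightarrow> (\<exists>c d. completes a b c d)"

text \<open>The choice of completion matters only up to a bounded error. Its determinant is recorded
  in \<open>completes\<close> because membership in the abstract set \<open>H\<close> does not
  determine it.\<close>

definition symb :: "'a \<Rightarrow> 'a \<Rightarrow> real" where
  "symb a b = f (SOME g. \<exists>c d. completes a b c d \<and> g = mat3 a b 0 c d 0 0 0 1)"

lemma completes_rowP: "completes a b c d \<Longrightarrow> rowP a b"
  unfolding rowP_def by blast

text \<open>Two completions of the same row differ by a lower triangular transvection.\<close>

lemma symb_approx:
  assumes "completes a b c d"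
  shows "\<bar>symb a b - f (mat3 a b 0 c d 0 0 0 1)\<bar> \<le> 8 * C"
proof -
  have "\<exists>g c d. completes a b c d \<and> g = mat3 a b 0 c d 0 0 0 1" using assms by blast
  from someI_ex[OF this] obtain c' d' where c': "completes a b c' d'"
    and s: "symb a b = f (mat3 a b 0 c' d' 0 0 0 1)"
    unfolding symb_def by metis
  have det: "a * d - b * c = 1" "a * d' - b * c' = 1"
    using assms c' unfolding completes_def by auto
  \<comment> \<open>The parameter is the lower left entry of the second completion times the inverse
    of the first. The result is written so that both determinants can be replaced by 1.\<close>
  have "mat3 1 0 0 (c' * d - d' * c) 1 0 0 0 1 * mat3 a b 0 c d 0 0 0 1 = mat3 a b 0
      (c' * (a * d - b * c) + c * (1 - (a * d' - b * c')))
      (d' * (a * d - b * c) + d * (1 - (a * d' - b * c'))) 0 0 0 1"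
    unfolding mat3_mult by (rule mat3_eqI) (simp_all add: algebra_simps)
  then have "mat3 1 0 0 (c' * d - d' * c) 1 0 0 0 1 * mat3 a b 0 c d 0 0 0 1 = mat3 a b 0 c' d' 0 0 0 1"
    using det by simp
  then show ?thesis
    using f_quasi[OF bnd_mem[OF bnd_transvections(3)[of "c' * d - d' * c"]], of "mat3 a b 0 c d 0 0 0 1"]
      bnd_transvections(3)[of "c' * d - d' * c"] assms s
    unfolding bnd_def completes_def by auto
qed

text \<open>Replacing each symbol by a value of \<open>f\<close> costs 8, and the product with
  \<open>x\<close> costs \<open>r + 1\<close>.\<close>

lemma symb_right_mult:
  assumes "completes a b c d" and "completes a' b' c' d'" and "bnd x r"
    and "mat3 a b 0 c d 0 0 0 1 * x = mat3 a' b' 0 c' d' 0 0 0 1"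
  shows "\<bar>symb a' b' - symb a b\<bar> \<le> (r + 17) * C"
  using symb_approx[OF assms(1)] symb_approx[OF assms(2)] assms(3,4)
    f_quasi[of "mat3 a b 0 c d 0 0 0 1" x] assms(1)
  unfolding bnd_def completes_def by (auto simp: algebra_simps)

lemma completes_right_mult:
  assumes "completes a b c d" and "bnd x r"
    and "mat3 a b 0 c d 0 0 0 1 * x = mat3 a' b' 0 c' d' 0 0 0 1" and "a' * d' - b' * c' = 1"
  shows "completes a' b' c' d'"
  using assms H_mult[of "mat3 a b 0 c d 0 0 0 1" x] unfolding bnd_def completes_def by auto

text \<open>All four moves are right multiplications by transvections or rotations; the worst case
  is \<open>23 + 17\<close>. The rotations interchange the two entries up to sign.\<close>

lemma symb_moves:
  assumes "rowP a b"
  shows "rowP (a + t * b) b" "\<bar>symb (a + t * b) b - symb a b\<bar> \<le> 40 * C"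
    "rowP a (b + t * a)" "\<bar>symb a (b + t * a) - symb a b\<bar> \<le> 40 * C"
    "rowP (- b) a" "\<bar>symb (- b) a - symb a b\<bar> \<le> 40 * C"
    "rowP b (- a)" "\<bar>symb b (- a) - symb a b\<bar> \<le> 40 * C"
proof -
  from assms obtain c d where g: "completes a b c d" unfolding rowP_def by blast
  then have det: "a * d - b * c = 1" unfolding completes_def by simp
  have 1: "mat3 a b 0 c d 0 0 0 1 * mat3 1 0 0 t 1 0 0 0 1 = mat3 (a + t * b) b 0 (c + t * d) d 0 0 0 1"
    and 2: "mat3 a b 0 c d 0 0 0 1 * mat3 1 t 0 0 1 0 0 0 1 = mat3 a (b + t * a) 0 c (d + t * c) 0 0 0 1"
    and 3: "mat3 a b 0 c d 0 0 0 1 * mat3 0 1 0 (- 1) 0 0 0 0 1 = mat3 (- b) a 0 (- d) c 0 0 0 1"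
    and 4: "mat3 a b 0 c d 0 0 0 1 * mat3 0 (- 1) 0 1 0 0 0 0 1 = mat3 b (- a) 0 d (- c) 0 0 0 1"
    by (simp_all add: mat3_mult algebra_simps)
  have c1: "completes (a + t * b) b (c + t * d) d"
    by (rule completes_right_mult[OF g bnd_transvections(3) 1]) (use det in \<open>simp add: algebra_simps\<close>)
  have c2: "completes a (b + t * a) c (d + t * c)"
    by (rule completes_right_mult[OF g bnd_transvections(1) 2]) (use det in \<open>simp add: algebra_simps\<close>)
  have c3: "completes (- b) a (- d) c"
    by (rule completes_right_mult[OF g bnd_rotations(1) 3]) (use det in \<open>simp add: algebra_simps\<close>)
  have c4: "completes b (- a) d (- c)"
    by (rule completes_right_mult[OF g bnd_rotations(2) 4]) (use det in \<open>simp add: algebra_simps\<close>)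
  show "rowP (a + t * b) b" "rowP a (b + t * a)" "rowP (- b) a" "rowP b (- a)"
    using c1 c2 c3 c4 by (blast intro: completes_rowP)+
  show "\<bar>symb (a + t * b) b - symb a b\<bar> \<le> 40 * C"
    using symb_right_mult[OF g c1 bnd_transvections(3) 1] C_nonneg by simp
  show "\<bar>symb a (b + t * a) - symb a b\<bar> \<le> 40 * C"
    using symb_right_mult[OF g c2 bnd_transvections(1) 2] C_nonneg by simp
  show "\<bar>symb (- b) a - symb a b\<bar> \<le> 40 * C"
    using symb_right_mult[OF g c3 bnd_rotations(1) 3] by simp
  show "\<bar>symb b (- a) - symb a b\<bar> \<le> 40 * C"
    using symb_right_mult[OF g c4 bnd_rotations(2) 4] by simp
qed

text \<open>Multiplying \<open>diag(g, 1)\<close> on the right by \<open>diag(1, g' w)\<close>, with \<open>w\<close> the rotation by a right angle,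
  changes the first row \<open>(a, b, 0)\<close> into \<open>(a, b b', - a b)\<close>, and a transvection clears the last entry.
  Conjugation by the signed cycle \<open>K\<close> moves the second completion to the lower right corner.\<close>

lemma symb_mult_snd:
  assumes "rowP a b" "rowP a b'"
  shows "rowP a (b * b')" "\<bar>symb a (b * b') - symb a b - symb a b'\<bar> \<le> 201 * C"
proof -
  obtain c d where g: "completes a b c d" using assms unfolding rowP_def by blast
  obtain c' d' where g': "completes a b' c' d'" using assms unfolding rowP_def by blast
  have det: "a * d - b * c = 1" "a * d' - b' * c' = 1"
    using g g' unfolding completes_def by auto
  define X where "X = mat3 a b 0 c d 0 0 0 1"
  define X' where "X' = mat3 a b' 0 c' d' 0 0 0 1"
  define K where "K = mat3 0 0 1 (- 1) 0 0 0 (- 1) (0 :: 'a)"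
  define K' where "K' = mat3 0 (- 1) 0 0 0 (- 1) 1 0 (0 :: 'a)"
  \<comment> \<open>The rotation sends the second row of \<open>X\<close>, negated, to the bottom;
    the parameter \<open>- c'\<close> makes the last entry of the new second row vanish in the final
    product.\<close>
  define L where "L = mat3 1 0 0 0 0 1 0 (- 1) 0 * mat3 1 0 0 0 1 0 0 (- c') 1"
  \<comment> \<open>After the rotation, adding \<open>b\<close> times the first column to the last
    clears \<open>- a * b\<close> and turns the bottom row into
    \<open>(- c, - d * b', a * d - b * c)\<close>. Its last entry is 1, and the other two factors
    use it to clear the rest of that row.\<close>
  define R where "R = mat3 1 0 0 0 0 (- 1) 0 1 0 * mat3 1 0 b 0 1 0 0 0 1 *
    mat3 1 0 0 0 1 0 c 0 1 * mat3 1 0 0 0 1 0 0 (d * b') 1"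
  have H: "X \<in> H" "X' \<in> H" using g g' unfolding completes_def X_def X'_def by auto
  have K: "bnd K 47" "bnd K' 47" unfolding K_def K'_def by (rule bnd_cycles)+
  have L: "bnd L 31"
    unfolding L_def using bnd_mult[OF bnd_rotations(3) bnd_transvections(6)[of "- c'"]] by simp
  have R: "bnd R 47"
    unfolding R_def using bnd_mult[OF bnd_mult[OF bnd_mult[OF bnd_rotations(4) bnd_transvections(2)[of b]]
      bnd_transvections(5)[of c]] bnd_transvections(6)[of "d * b'"]] by simp
  define G where "G = mat3 a (b * b') 0 (- c * c') (d' - c' * d * b') 0 0 0 1"
  have Y: "K * X' * K' = mat3 1 0 0 0 a b' 0 c' d'"
    unfolding K_def K'_def X'_def mat3_mult by (rule mat3_eqI) simp_all
  have LX: "L * X = mat3 a b 0 (- c * c') (- c' * d) 1 (- c) (- d) 0"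
    unfolding L_def X_def mat3_mult by (rule mat3_eqI) simp_all
  have R': "R = mat3 (1 + b * c) (b * d * b') b (- c) (- d * b') (- 1) 0 1 0"
    unfolding R_def mat3_mult by (rule mat3_eqI) simp_all
  have YR: "K * X' * K' * R = mat3 (1 + b * c) (b * d * b') b
      (- a * c) (b' - a * d * b') (- a) (- c * c') (d' - c' * d * b') (- c')"
    unfolding Y R' mat3_mult by (rule mat3_eqI) (simp_all add: algebra_simps)
  \<comment> \<open>The deviation of the determinant from 1 is kept as a symbol, so that the product
    below is a polynomial identity; setting \<open>e = 0\<close> then gives
    \<open>G\<close>.\<close>
  define e where "e = a * d - b * c - 1"
  have e: "e = 0" using det(1) by (simp add: e_def)
  have "L * X * (K * X' * K' * R) = mat3 a (b * b') 0 (- c * c' + c * c' * e)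
      (d' - c' * d * b' + c' * d * b' * e) (c' * e) (c * e) (d * b' * e) (1 + e)"
    unfolding LX YR mat3_mult e_def by (rule mat3_eqI) (simp_all add: algebra_simps)
  then have eq: "L * X * (K * X' * K' * R) = G"
    unfolding G_def e by simp
  have mem: "K \<in> H" "K' \<in> H" "L \<in> H" "R \<in> H"
    using K L R by (auto dest: bnd_mem)
  have GH: "G \<in> H" unfolding eq[symmetric] by (intro H_mult mem H)
  have compl: "completes a (b * b') (- c * c') (d' - c' * d * b')"
  proof -
    have "a * (d' - c' * d * b') - b * b' * (- c * c') = a * d' - b' * c' * (a * d - b * c)"
      by (simp add: algebra_simps)
    then show ?thesis unfolding completes_def using GH det by (simp add: G_def)
  qed
  then show "rowP a (b * b')" by (rule completes_rowP)
  have bounds: "\<bar>f K\<bar> \<le> 47 * C" "\<bar>f K'\<bar> \<le> 47 * C" "\<bar>f L\<bar> \<le> 31 * C" "\<bar>f R\<bar> \<le> 47 * C"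
    using K L R unfolding bnd_def by auto
  \<comment> \<open>The errors accumulate as \<open>96 = 47 + 47 + 2\<close>,
    \<open>144 = 96 + 47 + 1\<close>, \<open>177 = 144 + 31 + 2\<close>; three uses of
    \<open>symb_approx\<close> then give \<open>201 = 177 + 24\<close>.\<close>
  have "\<bar>f (K * X') - f K - f X'\<bar> \<le> C" "\<bar>f (K * X' * K') - f (K * X') - f K'\<bar> \<le> C"
    by (intro f_quasi H_mult mem H)+
  then have conj: "\<bar>f (K * X' * K') - f X'\<bar> \<le> 96 * C" using bounds by linarith
  have "\<bar>f (K * X' * K' * R) - f (K * X' * K') - f R\<bar> \<le> C"
    by (intro f_quasi H_mult mem H)
  then have right: "\<bar>f (K * X' * K' * R) - f X'\<bar> \<le> 144 * C" using conj bounds(4) by linarith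
  have "\<bar>f (L * X) - f L - f X\<bar> \<le> C"
    "\<bar>f (L * X * (K * X' * K' * R)) - f (L * X) - f (K * X' * K' * R)\<bar> \<le> C"
    by (intro f_quasi H_mult mem H)+
  then have "\<bar>f G - f X - f X'\<bar> \<le> 177 * C" using right bounds(3) unfolding eq by linarith
  then show "\<bar>symb a (b * b') - symb a b - symb a b'\<bar> \<le> 201 * C"
    using symb_approx[OF g] symb_approx[OF g'] symb_approx[OF compl]
    unfolding X_def[symmetric] X'_def[symmetric] G_def[symmetric] by linarith
qed

text \<open>Rotate both rows, multiply in the second entry and rotate back:
  \<open>321 = 201 + 3 * 40\<close>.\<close>

lemma symb_mult_fst:
  assumes "rowP a b" "rowP a' b"
  shows "rowP (a * a') b" "\<bar>symb (a * a') b - symb a b - symb a' b\<bar> \<le> 321 * C"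
proof -
  note swap = symb_moves(5,6)[OF assms(1)] symb_moves(5,6)[OF assms(2)]
  note prod = symb_mult_snd[OF swap(1,3)]
  note unswap = symb_moves(7,8)[OF prod(1)]
  show "rowP (a * a') b" using unswap by simp
  show "\<bar>symb (a * a') b - symb a b - symb a' b\<bar> \<le> 321 * C"
    using swap(2,4) prod(2) unswap(2) by simp
qed

lemma rowP_one_zero: "rowP 1 0"
  using one_mem by (intro completes_rowP[of _ _ 0 1]) (simp add: completes_def mat3_one)

sublocale approx_mennicke rowP symb "321 * C"
proof
  fix a b t :: 'a assume "rowP a b"
  show "\<bar>symb (a + t * b) b - symb a b\<bar> \<le> 321 * C"
    "\<bar>symb a (b + t * a) - symb a b\<bar> \<le> 321 * C"
    using symb_moves(2,4)[OF \<open>rowP a b\<close>, of t] C_nonneg by auto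
next
  fix a b b' :: 'a assume "rowP a b" "rowP a b'"
  then show "\<bar>symb a (b * b') - symb a b - symb a b'\<bar> \<le> 321 * C"
    using symb_mult_snd(2)[of a b b'] C_nonneg by auto
qed (fact symb_moves symb_mult_snd symb_mult_fst rowP_one_zero)+

end

section \<open>Invariance of the homogenized symbol under \<open>EL 2\<close>\<close>

context approx_mennicke
begin

text \<open>Elementary matrices act on rows by the moves that preserve \<open>mu\<close>. Membership
  in \<open>P\<close> is carried as an equivalence, so that the induction also passes through the
  rule for inverses.\<close>

lemma mu_EL2_action:
  assumes "M \<in> EL 2"
  shows "P a b \<longleftrightarrow> P (a * M $$ (0,0) + b * M $$ (1,0)) (a * M $$ (0,1) + b * M $$ (1,1))"
    and "P a b \<Longrightarrow> mu (a * M $$ (0,0) + b * M $$ (1,0)) (a * M $$ (0,1) + b * M $$ (1,1)) = mu a b"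
proof -
  define r where "r M v = (fst v * M $$ (0,0) + snd v * M $$ (1,0),
    fst v * M $$ (0,1) + snd v * M $$ (1,1))" for M :: "'a mat" and v
  have r_mult: "r (M * N) v = r N (r M v)"
    if "M \<in> carrier_mat 2 2" "N \<in> carrier_mat 2 2" for M N v
    using that by (auto simp: r_def scalar_prod_def numeral_2_eq_2 algebra_simps)
  have r_one: "r (1\<^sub>m 2) v = v" for v by (simp add: r_def)
  have "\<forall>v. (case_prod P v \<longleftrightarrow> case_prod P (r M v)) \<and>
    (case_prod P v \<longrightarrow> case_prod mu (r M v) = case_prod mu v)"
    using assms
  proof (induction rule: EL.induct)
    case (gen M)
    then obtain k l t where kl: "k < 2" "l < 2" "k \<noteq> l" and M: "M = addrow_mat 2 t k l"
      using elementary_mat_cases[OF gen] by auto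
    from kl consider "k = 0" "l = 1" | "k = 1" "l = 0" by fastforce
    then show ?case
    proof cases
      case 1
      have "P a (b + t * a) \<Longrightarrow> P a b" for a b
        using P_add_snd[of a "b + t * a" "- t"] by simp
      then show ?thesis
        using mu_add_snd P_add_snd by (auto simp: r_def M 1 add.commute mult.commute)
    next
      case 2
      have "P (a + t * b) b \<Longrightarrow> P a b" for a b
        using P_add_fst[of "a + t * b" b "- t"] by simp
      then show ?thesis
        using mu_add_fst P_add_fst by (auto simp: r_def M 2 add.commute mult.commute)
    qed
  next
    case (mult M N)
    have "r (M * N) v = r N (r M v)" for v
      using mult.hyps by (intro r_mult EL_carrier)
    then show ?case using mult.IH by metis
  next
    case (inv M N)
    have "r M (r N v) = v" for v
      using r_mult[OF inv(2) EL_carrier[OF inv(1)], of v] inv(4) r_one by simp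
    then show ?case using inv.IH by metis
  qed
  from spec[OF this, of "(a, b)"]
  show "P a b \<longleftrightarrow> P (a * M $$ (0,0) + b * M $$ (1,0)) (a * M $$ (0,1) + b * M $$ (1,1))"
    and "P a b \<Longrightarrow> mu (a * M $$ (0,0) + b * M $$ (1,0)) (a * M $$ (0,1) + b * M $$ (1,1)) = mu a b"
    by (auto simp: r_def)
qed

text \<open>The first row of \<open>M\<close> is the image of the row \<open>(1, 0)\<close>, where
  \<open>mu\<close> vanishes, and \<open>m\<close> stays within \<open>c\<close> of
  \<open>mu\<close>.\<close>

lemma symbol_EL2_bounded:
  assumes "M \<in> EL 2"
  shows "\<bar>m (M $$ (0,0)) (M $$ (0,1))\<bar> \<le> c"
proof -
  have "P (M $$ (0,0)) (M $$ (0,1))" "mu (M $$ (0,0)) (M $$ (0,1)) = 0"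
    using mu_EL2_action[OF assms, of 1 0] P_one_zero mu_one_zero by auto
  then show ?thesis using mu_approx_one[of "M $$ (0,0)" "M $$ (0,1)"] by simp
qed

end

section \<open>Vanishing on the corner\<close>

lemma EL2_det:
  assumes "M \<in> EL 2"
  shows "M $$ (0,0) * M $$ (1,1) - M $$ (0,1) * M $$ (1,0) = 1"
proof -
  define D where "D M = M $$ (0,0) * M $$ (1,1) - M $$ (0,1) * M $$ (1,0)" for M :: "'a mat"
  have D_mult: "D (M * N) = D M * D N"
    if "M \<in> carrier_mat 2 2" "N \<in> carrier_mat 2 2" for M N
    using that by (auto simp: D_def scalar_prod_def numeral_2_eq_2 algebra_simps)
  have "D M = 1" using assms
  proof (induction rule: EL.induct)
    case (gen M)
    then obtain k l t where "k < 2" "l < 2" "k \<noteq> l" "M = addrow_mat 2 t k l"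
      using elementary_mat_cases[OF gen] by auto
    then show ?case by (auto simp: D_def)
  next
    case (mult M N)
    then show ?case by (simp add: D_mult EL_carrier)
  next
    case (inv M N)
    have "D (1\<^sub>m 2) = 1" by (simp add: D_def)
    then show ?case using D_mult[OF EL_carrier[OF inv(1)] inv(2)] inv by simp
  qed
  then show ?thesis by (simp add: D_def)
qed

lemma stab_1_eq_mat3:
  assumes "M \<in> carrier_mat 2 2"
  shows "stab 1 M = mat3 (M $$ (0,0)) (M $$ (0,1)) 0 (M $$ (1,0)) (M $$ (1,1)) 0 0 0 1"
  using assms
  by (intro eq_matI) (auto simp: stab_def mat3_def less_3_iff)

lemma corner_embed_eq_stab: "M \<in> carrier_mat 2 2 \<Longrightarrow> corner_embed M = stab 4 M"
  unfolding corner_embed_def stab_def by auto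

lemma pow_mat_EL:
  assumes "M \<in> EL n" "k \<ge> 1"
  shows "M ^\<^sub>m k \<in> EL n"
  using assms(2)
proof (induction k rule: dec_induct)
  case base
  then show ?case using assms(1) EL_carrier[OF assms(1)] by simp
next
  case (step k)
  then show ?case using assms(1) by (simp add: EL.mult)
qed

text \<open>Homogeneity refers to powers in the group record; these are matrix powers computed in
  the small corner.\<close>

lemma stab_pow_mat:
  assumes "M \<in> carrier_mat n n"
  shows "stab l M [^]\<^bsub>EL_group (n + l)\<^esub> (k :: nat) = stab l (M ^\<^sub>m k)"
proof (induction k)
  case 0
  then show ?case using assms by (simp add: nat_pow_def EL_group_def stab_one)
next
  case (Suc k)
  have "stab l M [^]\<^bsub>EL_group (n + l)\<^esub> Suc k =
    (stab l M [^]\<^bsub>EL_group (n + l)\<^esub> k) * stab l M"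
    by (simp add: nat_pow_def EL_group_def)
  also have "\<dots> = stab l (M ^\<^sub>m Suc k)"
    using assms by (simp add: Suc stab_mult[of _ n])
  finally show ?case .
qed

theorem theorem1p5:
  fixes \<phi> :: "'a::comm_ring_1 mat \<Rightarrow> real"
  assumes "quasi_hom (EL_group 6) \<phi>"
      and "homogeneous (EL_group 6) \<phi>"
  shows "\<forall>g \<in> (EL 2 :: 'a mat set). \<phi> (corner_embed g) = 0"
proof
  fix g :: "'a mat" assume g: "g \<in> EL 2"
  obtain C where C: "\<And>x y. x \<in> EL 6 \<Longrightarrow> y \<in> EL 6 \<Longrightarrow> \<bar>\<phi> (x * y) - \<phi> x - \<phi> y\<bar> \<le> C"
    using assms(1) unfolding quasi_hom_def EL_group_def by auto
  define H :: "'a mat set" where "H = {x \<in> carrier_mat 3 3. stab 3 x \<in> EL 6}"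
  interpret quasi_hom_mat3 H "\<lambda>x. \<phi> (stab 3 x)" C
  proof
    fix x y assume "x \<in> H" "y \<in> H"
    then show "x * y \<in> H" "\<bar>\<phi> (stab 3 (x * y)) - \<phi> (stab 3 x) - \<phi> (stab 3 y)\<bar> \<le> C"
      unfolding H_def by (auto simp: stab_mult[of x 3 y] intro!: C EL.mult)
  next
    fix k l :: nat and a :: 'a assume "k < 3" "l < 3" "k \<noteq> l"
    then have "addrow_mat 3 a k l \<in> EL 3" by (intro EL.gen elementary_mat_addrow)
    then show "addrow_mat 3 a k l \<in> H"
      unfolding H_def using stab_EL[of "addrow_mat 3 a k l" 3 3] by simp
  qed
  \<comment> \<open>At most \<open>321 * C\<close> for the symbol of the first row and
    \<open>8 * C\<close> for passing from the symbol to this completion.\<close>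
  have bounded: "\<bar>\<phi> (stab 4 x)\<bar> \<le> 329 * C" if x: "x \<in> EL 2" for x
  proof -
    let ?y = "mat3 (x $$ (0,0)) (x $$ (0,1)) 0 (x $$ (1,0)) (x $$ (1,1)) 0 0 0 1"
    note carr = EL_carrier[OF x]
    have y: "stab 3 ?y = stab 4 x"
      using stab_stab[OF carr, of 3 1] unfolding stab_1_eq_mat3[OF carr] by simp
    have mem: "?y \<in> H"
      unfolding H_def using stab_EL[OF x, of 4] y by simp
    have "completes (x $$ (0,0)) (x $$ (0,1)) (x $$ (1,0)) (x $$ (1,1))"
      unfolding completes_def using EL2_det[OF x] mem by simp
    from symb_approx[OF this] symbol_EL2_bounded[OF x] show ?thesis
      unfolding y by linarith
  qed
  have "\<phi> (stab 4 g) = 0"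
  \<comment> \<open>All positive powers of \<open>g\<close> lie in \<open>EL 2\<close>, so the
    multiples \<open>n * \<phi> (stab 4 g)\<close> obey one common bound.\<close>
  proof (rule eq_of_bounded_multiples)
    fix n :: nat assume n: "n \<ge> 1"
    have "stab 4 g \<in> carrier (EL_group 6)"
      using stab_EL[OF g, of 4] by (simp add: EL_group_def)
    then have "\<phi> (stab 4 g [^]\<^bsub>EL_group 6\<^esub> int n) = of_int (int n) * \<phi> (stab 4 g)"
      using assms(2) unfolding homogeneous_def by blast
    then have "\<phi> (stab 4 (g ^\<^sub>m n)) = real n * \<phi> (stab 4 g)"
      using stab_pow_mat[OF EL_carrier[OF g], of 4 n] by (simp add: int_pow_int)
    then show "\<bar>real n * \<phi> (stab 4 g) - real n * 0\<bar> \<le> 329 * C"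
      using bounded[OF pow_mat_EL[OF g n]] by simp
  qed
  then show "\<phi> (corner_embed g) = 0"
    using corner_embed_eq_stab[OF EL_carrier[OF g]] by simp
qed

end
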